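(* Let $(f,U,y)$ be an admissible triple in $\mathbb{R}^k$. If $(g,U,z)$ is a regular triple which can be joined to $(f,U,y)$ via an admissible homotopy, then $$\deg(f,U,y)=\sum_{x\in g^{-1}(z)\cap U}\mathrm{i}(g,x).$$ In particular, this is true for any regular triple $(g,U,z)$ for which there are $\epsilon,\sigma>0$ such that: 1. $g$ is $\epsilon$-close to $f$, i.e. $|g(x)-f(x)|\le\epsilon$ for all $x\in\overline U$; 2. $z$ is $\sigma$-close to $y$, i.e. $|z-y|\le\sigma$; 3. $\epsilon+\sigma<\mathrm{dist}(y,f(\partial U))$.
   Context: Here $k$ is a positive integer, all maps are assumed continuous, and $\overline U$, $\partial U$ denote the closure and boundary of $U$ in $\mathbb{R}^k$. A map between metric spaces is proper if preimages of compact sets are compact. A function on a subset $X$ of $\mathbb{R}^k$ is $C^\infty$ if it admits a $C^\infty$ extension to an open neighborhood of $X$. Convention: $\mathrm{dist}(y,\emptyset)=+\infty$. Triples: $(f,U,y)$ consists of an open set $U\subseteq\mathbb{R}^k$, an $\mathbb{R}^k$-valued map $f$ defined (at least) on $\overline U$, and $y\in\mathbb{R}^k$. It is admissible if $f$ is proper on $\overline U$ (i.e. $f|_{\overline U}$ is proper) and $f(x)\neq y$ for all $x\in\partial U$. It is regular if it is admissible, $f$ is $C^\infty$, and $\det f'(x)\ne0$ for all $x\in f^{-1}(y)\cap U$ (this set is then finite). Index: if $f$ is Fréchet differentiable at $x$ with invertible derivative, $\mathrm{i}(f,x):=\mathrm{sign}(\det f'(x))$. Homotopies: $(H,U,\alpha)$,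 where $U\subseteq\mathbb{R}^k$ is open, $H$ is an $\mathbb{R}^k$-valued map defined (at least) on $\overline U\times[0,1]$ and $\alpha:[0,1]\to\mathbb{R}^k$ is a path, is an admissible homotopy, joining $(H(\cdot,0),U,\alpha(0))$ with $(H(\cdot,1),U,\alpha(1))$, if $H$ is proper on $\overline U\times[0,1]$ and $H(x,\lambda)\neq\alpha(\lambda)$ for all $(x,\lambda)\in\partial U\times[0,1]$. Degree (axiomatic point of view): $\deg$ is a map assigning to every admissible triple $(f,U,y)$ in $\mathbb{R}^k$ an integer $\deg(f,U,y)$ and satisfying: (Normalization) $\deg(I,\mathbb{R}^k,0)=1$, with $I$ the identity on $\mathbb{R}^k$; (Additivity) if $(f,U,y)$ is admissible and $U_1,U_2$ are disjoint open subsets of $U$ with $f^{-1}(y)\cap U\subseteq U_1\cup U_2$, then $\deg(f,U,y)=\deg(f,U_1,y)+\deg(f,U_2,y)$; (Homotopy Invariance) if $(H,U,\alpha)$ is an admissible homotopy, then $\deg(H(\cdot,0),U,\alpha(0))=\deg(H(\cdot,1),U,\alpha(1))$. *)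

theory Defs
  imports "HOL-Analysis.Analysis"
begin

text \<open>
  A map defined at least on a set \<open>X\<close> is represented by a total function of which only
  the restriction to \<open>X\<close> is ever constrained.  The dimension is \<open>CARD('k)\<close>.
\<close>

definition proper_on :: "'a::metric_space set \<Rightarrow> ('a \<Rightarrow> 'b::metric_space) \<Rightarrow> bool" where
  "proper_on X f \<longleftrightarrow> (\<forall>K. compact K \<longrightarrow> compact (X \<inter> f -` K))"

text \<open>
  \<open>C\<^sup>n\<close> on an open set: in finite dimension, \<open>f\<close> is \<open>C\<^sup>n\<^sup>+\<^sup>1\<close> iff it is differentiable and all
  its directional derivatives \<open>x \<mapsto> f'(x) v\<close> are \<open>C\<^sup>n\<close>.
\<close>

primrec Cn_on :: "nat \<Rightarrow> 'a::euclidean_space set \<Rightarrow> ('a \<Rightarrow> 'b::euclidean_space) \<Rightarrow> bool" where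
  "Cn_on 0 W f \<longleftrightarrow> continuous_on W f"
| "Cn_on (Suc n) W f \<longleftrightarrow>
     (\<forall>x\<in>W. f differentiable (at x)) \<and>
     (\<forall>v. Cn_on n W (\<lambda>x. frechet_derivative f (at x) v))"

definition Cinf_on :: "'a::euclidean_space set \<Rightarrow> ('a \<Rightarrow> 'b::euclidean_space) \<Rightarrow> bool" where
  "Cinf_on X f \<longleftrightarrow>
     (\<exists>W F. open W \<and> X \<subseteq> W \<and> (\<forall>n. Cn_on n W F) \<and> (\<forall>x\<in>X. F x = f x))"

definition jac_det :: "(real^'k \<Rightarrow> real^'k) \<Rightarrow> real^'k \<Rightarrow> real" where
  "jac_det f x = det (matrix (frechet_derivative f (at x)))"

definition admissible_triple ::
  "(real^'k \<Rightarrow> real^'k) \<Rightarrow> (real^'k) set \<Rightarrow> real^'k \<Rightarrow> bool" where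
  "admissible_triple f U y \<longleftrightarrow>
     open U \<and> continuous_on (closure U) f \<and> proper_on (closure U) f \<and>
     (\<forall>x\<in>frontier U. f x \<noteq> y)"

definition regular_triple ::
  "(real^'k \<Rightarrow> real^'k) \<Rightarrow> (real^'k) set \<Rightarrow> real^'k \<Rightarrow> bool" where
  "regular_triple f U y \<longleftrightarrow>
     admissible_triple f U y \<and> Cinf_on (closure U) f \<and>
     (\<forall>x\<in>f -` {y} \<inter> U. jac_det f x \<noteq> 0)"

text \<open>
  The index is only meaningful where \<open>f\<close> is differentiable with invertible derivative.
\<close>

definition index :: "(real^'k \<Rightarrow> real^'k) \<Rightarrow> real^'k \<Rightarrow> int" where
  "index f x = (if jac_det f x > 0 then 1 else if jac_det f x < 0 then - 1 else 0)"

definition admissible_homotopy ::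
  "((real^'k) \<times> real \<Rightarrow> real^'k) \<Rightarrow> (real^'k) set \<Rightarrow> (real \<Rightarrow> real^'k) \<Rightarrow> bool" where
  "admissible_homotopy H U \<alpha> \<longleftrightarrow>
     open U \<and> path \<alpha> \<and>
     continuous_on (closure U \<times> {0..1}) H \<and> proper_on (closure U \<times> {0..1}) H \<and>
     (\<forall>x\<in>frontier U. \<forall>t\<in>{0..1}. H (x, t) \<noteq> \<alpha> t)"

text \<open>
  As maps on \<open>closure U\<close>, the ends of the homotopy are the given ones; values elsewhere are
  irrelevant.
\<close>

definition admissibly_joined ::
  "(real^'k) set \<Rightarrow> (real^'k \<Rightarrow> real^'k) \<Rightarrow> real^'k \<Rightarrow>
   (real^'k \<Rightarrow> real^'k) \<Rightarrow> real^'k \<Rightarrow> bool" where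
  "admissibly_joined U g z f y \<longleftrightarrow>
     (\<exists>H \<alpha>. admissible_homotopy H U \<alpha> \<and>
        (\<forall>x\<in>closure U. H (x, 0) = g x) \<and> \<alpha> 0 = z \<and>
        (\<forall>x\<in>closure U. H (x, 1) = f x) \<and> \<alpha> 1 = y)"

definition is_degree ::
  "((real^'k \<Rightarrow> real^'k) \<Rightarrow> (real^'k) set \<Rightarrow> real^'k \<Rightarrow> int) \<Rightarrow> bool" where
  "is_degree deg \<longleftrightarrow>
     deg (\<lambda>x. x) UNIV 0 = 1 \<and>
     (\<forall>f U y U1 U2. admissible_triple f U y \<and> open U1 \<and> open U2 \<and> U1 \<subseteq> U \<and> U2 \<subseteq> U \<and>
        U1 \<inter> U2 = {} \<and> f -` {y} \<inter> U \<subseteq> U1 \<union> U2 \<longrightarrow>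
        deg f U y = deg f U1 y + deg f U2 y) \<and>
     (\<forall>H U \<alpha>. admissible_homotopy H U \<alpha> \<longrightarrow>
        deg (\<lambda>x. H (x, 0)) U (\<alpha> 0) = deg (\<lambda>x. H (x, 1)) U (\<alpha> 1))"

text \<open>
  Unlike \<^const>\<open>infdist\<close>, the distance to the empty set is \<open>\<infinity>\<close>.
\<close>

definition edist_set :: "'a::metric_space \<Rightarrow> 'a set \<Rightarrow> ereal" where
  "edist_set y A = (if A = {} then \<infinity> else ereal (infdist y A))"

text \<open>
  The zeros counted for a regular triple are finitely many, so sums over them are genuine.
\<close>

lemma regular_triple_finite:
  fixes f :: "real^'k \<Rightarrow> real^'k"
  assumes "regular_triple f U y"
  shows "finite (f -` {y} \<inter> U)"
proof -
  from assms have adm: "admissible_triple f U y" and sm: "Cinf_on (closure U) f"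
    and reg: "\<And>x. x \<in> f -` {y} \<inter> U \<Longrightarrow> jac_det f x \<noteq> 0"
    by (auto simp: regular_triple_def)
  have opn: "open U" using adm by (simp add: admissible_triple_def)
  define Z where "Z = f -` {y} \<inter> U"
  have "Z = closure U \<inter> f -` {y}"
    using adm closure_subset[of U]
    by (auto simp: Z_def admissible_triple_def frontier_def interior_open)
  moreover have "compact (closure U \<inter> f -` {y})"
    using adm by (auto simp: admissible_triple_def proper_on_def)
  ultimately have cZ: "compact Z" by simp
  obtain W F where W: "open W" "closure U \<subseteq> W" "\<And>n. Cn_on n W F" "\<And>x. x \<in> closure U \<Longrightarrow> F x = f x"
    using sm unfolding Cinf_on_def by blast
  have isol: "\<not> x islimpt Z" if x: "x \<in> Z" for x
  proof -
    have xU: "x \<in> U" "f x = y" using x by (auto simp: Z_def)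
    have "F differentiable (at x)"
      using W(3)[of "Suc 0"] W(2) xU closure_subset[of U] by auto
    then obtain D where "(F has_derivative D) (at x)" by (auto simp: differentiable_def)
    then have "(f has_derivative D) (at x)"
      by (rule has_derivative_transform_within_open[OF _ opn xU(1)])
        (use W(4) closure_subset[of U] in auto)
    then have "f differentiable (at x)" by (auto simp: differentiable_def)
    then have L: "(f has_derivative frechet_derivative f (at x)) (at x)"
      by (simp add: frechet_derivative_works)
    let ?L = "frechet_derivative f (at x)"
    have lin: "linear ?L" using L by (rule has_derivative_linear)
    have "invertible (matrix ?L)"
      using reg[of x] x by (simp add: Z_def jac_det_def invertible_det_nz)
    then have "inj ?L"
      using lin by (metis invertible_left_inverse matrix_left_invertible_injective
          matrix_vector_mul(2))
    then obtain c where c: "c > 0" "\<And>h. c * norm h \<le> norm (?L h)"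
      using linear_inj_bounded_below_pos[OF lin] by (metis mult.commute)
    from L c(1) obtain d where d: "d > 0"
      "\<And>w. norm (w - x) < d \<Longrightarrow> norm (f w - f x - ?L (w - x)) \<le> c/2 * norm (w - x)"
      unfolding has_derivative_at_alt by (meson half_gt_zero)
    have "w = x" if w: "w \<in> Z" "dist w x < d" for w
    proof -
      have "f w = f x" using w x by (auto simp: Z_def)
      then have "norm (?L (w - x)) \<le> c/2 * norm (w - x)"
        using d(2)[of w] w by (simp add: dist_norm)
      with c(2)[of "w - x"] have "c * norm (w - x) \<le> c/2 * norm (w - x)" by linarith
      with c(1) have "norm (w - x) \<le> 0" by (simp add: mult_le_cancel_right)
      then show ?thesis by simp
    qed
    then show ?thesis
      using d(1) unfolding islimpt_approachable by blast
  qed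
  have "finite Z"
  proof (rule ccontr)
    assume "infinite Z"
    with cZ obtain x where "x \<in> Z" "x islimpt Z"
      using Heine_Borel_imp_Bolzano_Weierstrass[of Z Z] by auto
    with isol show False by blast
  qed
  then show ?thesis by (simp add: Z_def)
qed

end

theory Submission
  imports Defs
begin

text \<open>
  Homotopy invariance reduces both claims to the degree of the regular triple \<open>(g, U, z)\<close>; in the
  second one the homotopy is affine, and properness survives because a map at bounded distance
  from a proper map is proper.  Additivity localises the degree to small balls around the zeros,
  and there \<open>g\<close> is homotopic to its linearisation, so only invertible linear maps remain.  These
  are products of diagonal maps and shears (a swap of coordinates is a product of shears and
  reflections); shears and positive scalings are homotopic to the identity, and a reflection
  changes the sign of the degree because folding along a coordinate has degree 0.
\<close>

section \<open>Criteria for properness and admissibility\<close>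

text \<open>Continuity makes preimages of compact sets closed in \<open>X\<close>, so by Heine-Borel
  only boundedness is left to check.\<close>

lemma proper_on_bounded_preimage:
  fixes f :: "'a::heine_borel \<Rightarrow> 'b::metric_space"
  assumes "closed X" "continuous_on X f"
    and "\<And>K. compact K \<Longrightarrow> bounded (X \<inter> f -` K)"
  shows "proper_on X f"
  unfolding proper_on_def
proof (intro allI impI)
  fix K :: "'b set" assume "compact K"
  then show "compact (X \<inter> f -` K)"
    using assms(3) continuous_closed_preimage[OF assms(2,1) compact_imp_closed]
    by (simp add: compact_eq_bounded_closed)
qed

lemma proper_on_compact:
  fixes f :: "'a::heine_borel \<Rightarrow> 'b::metric_space"
  assumes "compact X" "continuous_on X f"
  shows "proper_on X f"
  using assms
  by (intro proper_on_bounded_preimage compact_imp_closed)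
    (auto intro: bounded_subset[OF compact_imp_bounded])

lemma proper_on_subset:
  assumes "proper_on X f" "closed Y" "Y \<subseteq> X"
  shows "proper_on Y f"
  unfolding proper_on_def
proof (intro allI impI)
  fix K :: "'b set" assume "compact K"
  then have "compact (X \<inter> f -` K)" using assms(1) by (simp add: proper_on_def)
  moreover have "Y \<inter> f -` K = (X \<inter> f -` K) \<inter> Y" using assms(3) by blast
  ultimately show "compact (Y \<inter> f -` K)" using assms(2) compact_Int_closed by metis
qed

lemma proper_on_cong:
  assumes "\<And>x. x \<in> X \<Longrightarrow> f x = g x"
  shows "proper_on X f \<longleftrightarrow> proper_on X g"
proof -
  have "X \<inter> f -` K = X \<inter> g -` K" for K using assms by auto
  then show ?thesis by (simp add: proper_on_def)
qed

text \<open>The growth bound is uniform in \<open>t\<close>, so the preimage of a ball of radius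
  \<open>R\<close> has its first components in the ball of radius \<open>(R + M) / c\<close>. The
  constant \<open>M\<close> absorbs bounded perturbations such as translations.\<close>

lemma proper_on_coercive:
  fixes H :: "'a::euclidean_space \<times> real \<Rightarrow> 'b::real_normed_vector"
  assumes "continuous_on (UNIV \<times> {0..1}) H" "c > 0"
    and "\<And>w t. 0 \<le> t \<Longrightarrow> t \<le> 1 \<Longrightarrow> c * norm w \<le> norm (H (w, t)) + M"
  shows "proper_on (UNIV \<times> {0..1}) H"
proof (rule proper_on_bounded_preimage)
  show "closed (UNIV \<times> {0..1::real} :: ('a \<times> real) set)" by (intro closed_Times) auto
  show "continuous_on (UNIV \<times> {0..1}) H" by fact
  fix K :: "'b set" assume "compact K"
  then obtain R where R: "\<And>v. v \<in> K \<Longrightarrow> norm v \<le> R"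
    using compact_imp_bounded bounded_iff by metis
  have "UNIV \<times> {0..1} \<inter> H -` K \<subseteq> cball 0 ((R + M) / c) \<times> {0..1}"
  proof clarsimp
    fix w t assume "H (w, t) \<in> K" "0 \<le> t" "t \<le> (1::real)"
    then show "norm w \<le> (R + M) / c"
      using R[of "H (w, t)"] assms(3)[of t w] assms(2) by (simp add: field_simps)
  qed
  moreover have "bounded (cball (0::'a) ((R + M) / c) \<times> {0..1::real})"
    by (intro bounded_Times) auto
  ultimately show "bounded (UNIV \<times> {0..1} \<inter> H -` K)" using bounded_subset by blast
qed

lemma proper_on_linear:
  fixes L :: "real^'k \<Rightarrow> real^'k"
  assumes "linear L" "inj L"
  shows "proper_on UNIV (\<lambda>w. L w + a)"
proof (rule proper_on_bounded_preimage)
  show "continuous_on UNIV (\<lambda>w. L w + a)"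
    using assms(1) by (intro continuous_intros linear_continuous_on linear_linear[THEN iffD2])
  obtain c where c: "c > 0" "\<And>w. c * norm w \<le> norm (L w)"
    using linear_inj_bounded_below_pos[OF assms] by (metis mult.commute)
  fix K :: "(real^'k) set" assume "compact K"
  then obtain R where R: "\<And>v. v \<in> K \<Longrightarrow> norm v \<le> R"
    using compact_imp_bounded bounded_iff by metis
  have "norm w \<le> (R + norm a) / c" if "L w + a \<in> K" for w
    using R[OF that] c(2)[of w] c(1) norm_triangle_ineq4[of "L w + a" a]
    by (simp add: field_simps)
  then show "bounded (UNIV \<inter> (\<lambda>w. L w + a) -` K)"
    unfolding bounded_iff by auto
qed auto

text \<open>A zero on the frontier of \<open>V\<close> would lie in \<open>V'\<close>, which is open and disjoint from \<open>V\<close>.\<close>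

lemma admissible_triple_part:
  assumes "admissible_triple f U y" "open V" "V \<subseteq> U" "open V'" "V \<inter> V' = {}"
    and "f -` {y} \<inter> U \<subseteq> V \<union> V'"
  shows "admissible_triple f V y"
proof -
  have cl: "closure V \<subseteq> closure U" using assms(3) by (rule closure_mono)
  have "f x \<noteq> y" if "x \<in> frontier V" for x
  proof
    assume "f x = y"
    have "x \<in> closure V" "x \<notin> V" using that assms(2) by (auto simp: frontier_def interior_open)
    moreover have "x \<notin> frontier U" using \<open>f x = y\<close> assms(1) by (auto simp: admissible_triple_def)
    ultimately have "x \<in> U"
      using cl assms(1) by (auto simp: frontier_def interior_open admissible_triple_def)
    with \<open>f x = y\<close> \<open>x \<notin> V\<close> assms(6) have "x \<in> V'" by auto
    moreover have "closure V \<inter> V' = {}"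
      using assms(4,5) open_Int_closure_eq_empty[of V' V] by (simp add: Int_commute)
    ultimately show False using \<open>x \<in> closure V\<close> by blast
  qed
  with assms cl show ?thesis
    unfolding admissible_triple_def
    by (auto intro: continuous_on_subset proper_on_subset)
qed

lemma admissible_linear:
  fixes L :: "real^'k \<Rightarrow> real^'k"
  assumes "linear L" "inj L"
  shows "admissible_triple (\<lambda>w. L w + a) UNIV b"
proof -
  have "continuous_on UNIV (\<lambda>w. L w + a)"
    using assms(1) by (intro continuous_intros linear_continuous_on linear_linear[THEN iffD2])
  then show ?thesis
    using proper_on_linear[OF assms] by (simp add: admissible_triple_def)
qed

text \<open>Supplies admissibility of the ends of a homotopy. Compactness comes from projecting with
  \<open>fst\<close> a compact preimage cut down to time \<open>t\<close>.\<close>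

lemma admissible_homotopy_slice:
  assumes "admissible_homotopy H U \<alpha>" "t \<in> {0..1}"
  shows "admissible_triple (\<lambda>x. H (x, t)) U (\<alpha> t)"
proof -
  have "compact (closure U \<inter> (\<lambda>x. H (x, t)) -` K)" if "compact K" for K
  proof -
    have "compact ((closure U \<times> {0..1} \<inter> H -` K) \<inter> (UNIV \<times> {t}))"
      using assms(1) that
      by (intro compact_Int_closed[OF _ closed_Times])
        (auto simp: admissible_homotopy_def proper_on_def)
    then have "compact (fst ` ((closure U \<times> {0..1} \<inter> H -` K) \<inter> (UNIV \<times> {t})))"
      by (intro compact_continuous_image continuous_intros)
    moreover have "fst ` ((closure U \<times> {0..1} \<inter> H -` K) \<inter> (UNIV \<times> {t})) =
        closure U \<inter> (\<lambda>x. H (x, t)) -` K"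
      using assms(2) by force
    ultimately show ?thesis by simp
  qed
  moreover have "continuous_on (closure U) (\<lambda>x. H (x, t))"
    using assms unfolding admissible_homotopy_def
    by (auto intro!: continuous_on_compose2[of "closure U \<times> {0..1}" H] continuous_intros)
  ultimately show ?thesis
    using assms by (auto simp: admissible_homotopy_def admissible_triple_def proper_on_def)
qed

lemma sgn_prod:
  fixes c :: "'i \<Rightarrow> 'b::linordered_idom"
  shows "sgn (\<Prod>i\<in>S. c i) = (\<Prod>i\<in>S. sgn (c i))"
  by (induction S rule: infinite_finite_induct) (auto simp: sgn_mult)

lemma linear_diagonal: "linear (\<lambda>w::real^'k. \<chi> i. c i * w $ i)"
  by (rule linearI) (auto simp: vec_eq_iff algebra_simps)

lemma inj_diagonal:
  assumes "\<And>i. c i \<noteq> (0::real)"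
  shows "inj (\<lambda>w::real^'k. \<chi> i. c i * w $ i)"
  by (rule injI) (use assms in \<open>simp add: vec_eq_iff\<close>)

section \<open>Formal consequences of the degree axioms\<close>

locale degree_map =
  fixes deg :: "(real^'k \<Rightarrow> real^'k) \<Rightarrow> (real^'k) set \<Rightarrow> real^'k \<Rightarrow> int"
  assumes is_degree: "is_degree deg"
begin

lemma deg_identity: "deg (\<lambda>x. x) UNIV 0 = 1"
  using is_degree by (simp add: is_degree_def)

lemma deg_additive:
  assumes "admissible_triple f U y" "open U1" "open U2" "U1 \<subseteq> U" "U2 \<subseteq> U" "U1 \<inter> U2 = {}"
    and "f -` {y} \<inter> U \<subseteq> U1 \<union> U2"
  shows "deg f U y = deg f U1 y + deg f U2 y"
  using is_degree[unfolded is_degree_def, THEN conjunct2, THEN conjunct1, rule_format] assms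
  by simp

lemma deg_no_zeros:
  assumes "admissible_triple f U y" "f -` {y} \<inter> U = {}"
  shows "deg f U y = 0"
proof -
  have "deg f U y = deg f {} y + deg f {} y"
    by (rule deg_additive) (use assms in \<open>auto simp: admissible_triple_def\<close>)
  \<comment> \<open>Splitting the empty set into two copies of itself gives
    \<open>d = d + d\<close>, so the degree over it is 0.\<close>
  moreover have "deg f {} y = deg f {} y + deg f {} y"
    by (rule deg_additive) (auto simp: admissible_triple_def proper_on_def)
  ultimately show ?thesis by simp
qed

lemma deg_excision:
  assumes "admissible_triple f U y" "open V" "V \<subseteq> U" "f -` {y} \<inter> U \<subseteq> V"
  shows "deg f U y = deg f V y"
proof -
  have "deg f U y = deg f V y + deg f {} y"
    by (rule deg_additive) (use assms in auto)
  moreover have "deg f {} y = 0"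
    by (rule deg_no_zeros) (auto simp: admissible_triple_def proper_on_def)
  ultimately show ?thesis by simp
qed

text \<open>The axiom compares the literal slices of \<open>H\<close>, which are total functions,
  while here the ends match \<open>f\<close> and \<open>g\<close> only on \<open>closure U\<close>.
  Replacing \<open>H\<close> by \<open>G\<close>, which has exactly \<open>f\<close> and
  \<open>g\<close> as slices and is unchanged on \<open>closure U \<times> {0..1}\<close>, bridges
  the gap.\<close>

lemma deg_homotopy:
  assumes H: "admissible_homotopy H U \<alpha>"
    and "\<And>x. x \<in> closure U \<Longrightarrow> H (x, 0) = f x" "\<alpha> 0 = y"
    and "\<And>x. x \<in> closure U \<Longrightarrow> H (x, 1) = g x" "\<alpha> 1 = z"
  shows "deg f U y = deg g U z"
proof -
  define G where "G = (\<lambda>(x, t). if t = 0 then f x else if t = 1 then g x else H (x, t))"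
  have eq: "G p = H p" if "p \<in> closure U \<times> {0..1}" for p
    using that assms by (auto simp: G_def)
  have "x \<in> closure U" if "x \<in> frontier U" for x
    using that by (simp add: frontier_def)
  then have "admissible_homotopy G U \<alpha>"
    using H eq unfolding admissible_homotopy_def
    by (auto simp: continuous_on_cong[OF refl eq] proper_on_cong[OF eq])
  then have "deg (\<lambda>x. G (x, 0)) U (\<alpha> 0) = deg (\<lambda>x. G (x, 1)) U (\<alpha> 1)"
    using is_degree by (simp add: is_degree_def)
  then show ?thesis using assms by (simp add: G_def)
qed

text \<open>The constant homotopy suffices, because its end at time 1 has to match \<open>g\<close>
  on \<open>closure U\<close> only.\<close>

lemma deg_cong:
  assumes "admissible_triple f U y" "\<And>x. x \<in> closure U \<Longrightarrow> f x = g x"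
  shows "deg f U y = deg g U y"
proof (rule deg_homotopy[where H = "\<lambda>p. f (fst p)" and \<alpha> = "\<lambda>_. y"])
  have "closure U \<times> {0..1} \<inter> (\<lambda>p. f (fst p)) -` K = (closure U \<inter> f -` K) \<times> {0..1::real}" for K
    by auto
  then have "proper_on (closure U \<times> {0..1::real}) (\<lambda>p. f (fst p))"
    using assms(1) by (simp add: proper_on_def compact_Times admissible_triple_def)
  moreover have "continuous_on (closure U \<times> {0..1::real}) (\<lambda>p. f (fst p))"
    using assms(1) unfolding admissible_triple_def
    by (auto intro!: continuous_on_compose2[of "closure U" f _ fst] continuous_intros)
  ultimately show "admissible_homotopy (\<lambda>p. f (fst p)) U (\<lambda>_. y)"
    using assms(1) by (auto simp: admissible_homotopy_def admissible_triple_def path_def)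
qed (use assms in auto)

lemma deg_additive_finite:
  assumes "finite S" "admissible_triple f U y"
    and "\<And>i. i \<in> S \<Longrightarrow> open (V i)" "\<And>i. i \<in> S \<Longrightarrow> V i \<subseteq> U" "disjoint_family_on V S"
    and "f -` {y} \<inter> U \<subseteq> (\<Union>i\<in>S. V i)"
  shows "deg f U y = (\<Sum>i\<in>S. deg f (V i) y)"
  using assms
\<comment> \<open>\<open>U\<close> is generalised because the induction hypothesis is applied to the
  smaller open set \<open>?W\<close>.\<close>
proof (induction S arbitrary: U rule: finite_induct)
  case empty
  then show ?case by (simp add: deg_no_zeros)
next
  case (insert a S)
  let ?W = "\<Union>i\<in>S. V i"
  have W: "open ?W" "?W \<subseteq> U" using insert.prems by auto
  have disj: "V a \<inter> ?W = {}"
    using insert.prems(4) insert.hyps unfolding disjoint_family_on_def by auto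
  have cover: "f -` {y} \<inter> U \<subseteq> V a \<union> ?W" using insert.prems by auto
  have adm: "admissible_triple f ?W y"
    by (rule admissible_triple_part[OF insert.prems(1) W, where V' = "V a"])
      (use insert.prems disj cover in auto)
  have "deg f U y = deg f (V a) y + deg f ?W y"
    by (rule deg_additive) (use insert.prems W disj cover in auto)
  also have "deg f ?W y = (\<Sum>i\<in>S. deg f (V i) y)"
  proof (rule insert.IH[OF adm])
    show "disjoint_family_on V S"
      using insert.prems(4) by (auto simp: disjoint_family_on_def)
  qed (use insert.prems in auto)
  finally show ?case using insert.hyps by simp
qed

section \<open>Degree of injective linear maps on the whole space\<close>

text \<open>Translation and target are switched on together by the factor \<open>t\<close>.
  Injectivity bounds \<open>L\<close> from below, and the translation costs at most
  \<open>norm a\<close>, which gives properness.\<close>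

lemma deg_affine:
  assumes "linear L" "inj L"
  shows "deg (\<lambda>w. L w + a) UNIV b = deg L UNIV 0"
proof (rule deg_homotopy[symmetric, where H = "\<lambda>(w, t). L w + t *\<^sub>R a" and \<alpha> = "\<lambda>t. t *\<^sub>R b"])
  have cont: "continuous_on (UNIV \<times> {0..1}) (\<lambda>(w, t). L w + t *\<^sub>R a)"
    unfolding case_prod_beta
    by (intro continuous_intros linear_continuous_on_compose[OF _ assms(1)])
  obtain c where c: "c > 0" "\<And>w. c * norm w \<le> norm (L w)"
    using linear_inj_bounded_below_pos[OF assms] by (metis mult.commute)
  have "proper_on (UNIV \<times> {0..1}) (\<lambda>(w, t). L w + t *\<^sub>R a)"
  proof (rule proper_on_coercive[OF cont c(1)])
    fix w and t :: real assume t: "0 \<le> t" "t \<le> 1"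
    have "norm (t *\<^sub>R a) \<le> norm a" using t by (simp add: mult_left_le_one_le)
    then show "c * norm w \<le> norm ((\<lambda>(w, t). L w + t *\<^sub>R a) (w, t)) + norm a"
      using c(2)[of w] norm_triangle_ineq4[of "L w + t *\<^sub>R a" "t *\<^sub>R a"] by simp
  qed
  with cont show "admissible_homotopy (\<lambda>(w, t). L w + t *\<^sub>R a) UNIV (\<lambda>t. t *\<^sub>R b)"
    by (simp add: admissible_homotopy_def path_def continuous_intros)
qed auto

text \<open>Since \<open>UNIV\<close> has empty frontier, properness is the point to prove. It
  follows from a lower bound for \<open>L t\<close> uniform in \<open>t\<close>: the minimum of
  \<open>norm (L t w)\<close> over unit vectors and times is attained, hence positive by
  injectivity.\<close>

lemma deg_linear_path:
  fixes L :: "real \<Rightarrow> real^'k \<Rightarrow> real^'k"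
  assumes lin: "\<And>t. 0 \<le> t \<Longrightarrow> t \<le> 1 \<Longrightarrow> linear (L t)"
    and inj: "\<And>t. 0 \<le> t \<Longrightarrow> t \<le> 1 \<Longrightarrow> inj (L t)"
    and cont: "continuous_on (UNIV \<times> {0..1}) (\<lambda>(w, t). L t w)"
  shows "deg (L 0) UNIV 0 = deg (L 1) UNIV 0"
proof (rule deg_homotopy[where H = "\<lambda>(w, t). L t w" and \<alpha> = "\<lambda>_. 0"])
  let ?S = "sphere (0::real^'k) 1 \<times> {0..1::real}"
  have "compact ?S" "?S \<noteq> {}" by (auto simp: compact_Times)
  moreover have "continuous_on ?S (\<lambda>p. norm ((\<lambda>(w, t). L t w) p))"
    by (intro continuous_on_norm continuous_on_subset[OF cont]) auto
  ultimately obtain p where p: "p \<in> ?S"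
    "\<And>q. q \<in> ?S \<Longrightarrow> norm ((\<lambda>(w, t). L t w) p) \<le> norm ((\<lambda>(w, t). L t w) q)"
    using continuous_attains_inf by meson
  define c where "c = norm ((\<lambda>(w, t). L t w) p)"
  obtain v s where vs: "p = (v, s)" "norm v = 1" "0 \<le> s" "s \<le> 1" using p(1) by auto
  then have "L s v \<noteq> 0"
    using linear_injective_0[OF lin] inj by (metis norm_zero zero_neq_one)
  then have c0: "c > 0" using vs by (simp add: c_def)
  have c: "c * norm w \<le> norm (L t w)" if t: "0 \<le> t" "t \<le> 1" for t w
  proof (cases "w = 0")
    case False
    \<comment> \<open>Homogeneity carries the bound from the unit sphere to the whole space.\<close>
    have "c \<le> norm (L t (inverse (norm w) *\<^sub>R w))"
      using p(2)[of "(inverse (norm w) *\<^sub>R w, t)"] t False by (simp add: c_def)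
    also have "\<dots> = norm (L t w) / norm w"
      by (simp add: linear_scale[OF lin[OF t]] divide_inverse mult.commute)
    finally show ?thesis using False by (simp add: field_simps)
  qed auto
  have "proper_on (UNIV \<times> {0..1}) (\<lambda>(w, t). L t w)"
    by (rule proper_on_coercive[OF cont c0, where M = 0]) (use c in auto)
  with cont show "admissible_homotopy (\<lambda>(w, t). L t w) UNIV (\<lambda>_. 0)"
    by (simp add: admissible_homotopy_def path_def)
qed auto

text \<open>Coefficients of equal sign can be interpolated without passing through 0. The outer
  factor \<open>B\<close>, here and below, lets elementary factors be removed from a composition one
  at a time.\<close>

lemma deg_diagonal_homotopy:
  assumes "linear B" "inj B" "\<And>i. c i * d i > 0"
  shows "deg (\<lambda>w. B (\<chi> i. c i * w $ i)) UNIV 0 = deg (\<lambda>w. B (\<chi> i. d i * w $ i)) UNIV 0"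
proof -
  define L where "L = (\<lambda>t w. B (\<chi> i. ((1 - t) * c i + t * d i) * w $ i))"
  have "deg (L 0) UNIV 0 = deg (L 1) UNIV 0"
  proof (rule deg_linear_path)
    fix t :: real assume t: "0 \<le> t" "t \<le> 1"
    have nz: "(1 - t) * c i + t * d i \<noteq> 0" for i
    proof -
      consider "c i > 0" "d i > 0" | "c i < 0" "d i < 0"
        using assms(3)[of i] by (auto simp: zero_less_mult_iff)
      then show ?thesis
      proof cases
        case 1
        then have "(1 - t) * c i + t * d i \<ge> (1 - t) * min (c i) (d i) + t * min (c i) (d i)"
          using t by (intro add_mono mult_left_mono) auto
        with 1 show ?thesis by (auto simp: algebra_simps)
      next
        case 2
        then have "(1 - t) * c i + t * d i \<le> (1 - t) * max (c i) (d i) + t * max (c i) (d i)"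
          using t by (intro add_mono mult_left_mono) auto
        with 2 show ?thesis by (auto simp: algebra_simps)
      qed
    qed
    show "linear (L t)"
      using linear_compose[OF linear_diagonal assms(1)] by (simp add: L_def o_def)
    show "inj (L t)"
      using inj_compose[OF assms(2) inj_diagonal[OF nz]] by (simp add: L_def o_def)
  next
    show "continuous_on (UNIV \<times> {0..1}) (\<lambda>(w, t). L t w)"
      unfolding L_def case_prod_beta
      by (intro linear_continuous_on_compose[OF _ assms(1)] continuous_intros)
  qed
  then show ?thesis by (simp add: L_def)
qed

text \<open>
  The folding map \<open>w\<^sub>k \<mapsto> \<bar>w\<^sub>k\<bar> - 1\<close> can be pushed off zero, so it has degree 0; additivity splits
  this 0 into the degree of the identity and that of the reflection.
\<close>

lemma deg_reflection:
  assumes "linear B" "inj B"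
  shows "deg (\<lambda>w. B (\<chi> i. (if i = k then - 1 else 1) * w $ i)) UNIV 0 = - deg B UNIV 0"
proof -
  define R :: "real^'k \<Rightarrow> real^'k" where "R = (\<lambda>w. \<chi> i. (if i = k then - 1 else 1) * w $ i)"
  define A :: "real^'k \<Rightarrow> real^'k" where "A = (\<lambda>w. \<chi> i. if i = k then \<bar>w $ k\<bar> else w $ i)"
  define e :: "real^'k" where "e = axis k 1"
  \<comment> \<open>The zeros solve \<open>A w = (1 - 2 * t) *\<^sub>R e\<close>. At time 0 they are
    \<open>e\<close> and \<open>- e\<close>; at time 1 there are none, because the
    \<open>k\<close>-th coordinate of \<open>A w\<close> is nonnegative.\<close>
  define H where "H = (\<lambda>(w, t). B (A w) + (2 * t - 1) *\<^sub>R B e)"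
  have R: "linear R" "\<And>w. R (R w) = w"
    unfolding R_def by (rule linearI) (auto simp: vec_eq_iff algebra_simps)
  then have BR: "linear (\<lambda>w. B (R w))" "inj (\<lambda>w. B (R w))"
    using assms linear_compose[OF R(1) assms(1)] unfolding inj_def o_def by metis+
  \<comment> \<open>Folding keeps the absolute value of every coordinate, so
    \<open>B \<circ> A\<close> inherits the growth bound of \<open>B\<close>.\<close>
  have normA: "norm w \<le> norm (A w)" for w
    by (rule norm_le_componentwise_cart) (simp add: A_def)
  have "continuous_on UNIV (\<lambda>w. A w $ i)" for i
    by (cases "i = k") (auto simp: A_def intro!: continuous_intros)
  then have "continuous_on UNIV (\<lambda>w. \<chi> i. A w $ i)" by (rule continuous_on_vec_lambda)
  then have contA: "continuous_on UNIV A" by simp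
  have cont: "continuous_on (UNIV \<times> {0..1}) H"
    unfolding H_def case_prod_beta
    by (intro continuous_intros linear_continuous_on_compose[OF _ assms(1)]
        continuous_on_compose2[OF contA]) auto
  obtain c where c: "c > 0" "\<And>w. c * norm w \<le> norm (B w)"
    using linear_inj_bounded_below_pos[OF assms] by metis
  have "proper_on (UNIV \<times> {0..1}) H"
  proof (rule proper_on_coercive[OF cont c(1)])
    fix w and t :: real assume t: "0 \<le> t" "t \<le> 1"
    have "c * norm w \<le> norm (B (A w))"
      using normA[of w] c(1) c(2)[of "A w"] by (meson less_imp_le mult_left_mono order_trans)
    also have "\<dots> \<le> norm (H (w, t)) + norm ((2 * t - 1) *\<^sub>R B e)"
      using norm_triangle_ineq4[of "H (w, t)" "(2 * t - 1) *\<^sub>R B e"] by (simp add: H_def)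
    also have "norm ((2 * t - 1) *\<^sub>R B e) \<le> norm (B e)"
      using t by (simp add: mult_left_le_one_le)
    finally show "c * norm w \<le> norm (H (w, t)) + norm (B e)" by simp
  qed
  with cont have H: "admissible_homotopy H UNIV (\<lambda>_. 0)"
    by (simp add: admissible_homotopy_def path_def)
  have zeros: "H (w, t) = 0 \<longleftrightarrow> A w = (1 - 2 * t) *\<^sub>R e" for w t
  proof -
    have "H (w, t) = B (A w) - B ((1 - 2 * t) *\<^sub>R e)"
      by (simp add: H_def linear_scale[OF assms(1)] linear_diff[OF assms(1)]
          scaleR_left_diff_distrib)
    then show ?thesis using inj_eq[OF assms(2)] by simp
  qed
  have "deg (\<lambda>w. H (w, 1)) UNIV 0 = 0"
  proof (rule deg_no_zeros)
    show "admissible_triple (\<lambda>w. H (w, 1)) UNIV 0"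
      using admissible_homotopy_slice[OF H, of 1] by simp
    have "A w $ k \<noteq> - e $ k" for w by (simp add: A_def e_def)
    then show "(\<lambda>w. H (w, 1)) -` {0} \<inter> UNIV = {}"
      by (auto simp: zeros) (metis vector_uminus_component)
  qed
  then have H0: "deg (\<lambda>w. H (w, 0)) UNIV 0 = 0"
    using deg_homotopy[OF H refl refl refl refl] by simp
  have adm: "admissible_triple (\<lambda>w. H (w, 0)) UNIV 0"
    using admissible_homotopy_slice[OF H, of 0] by simp
  \<comment> \<open>These half-spaces separate the two zeros at time 0. On their closures
    \<open>A\<close> is the identity and \<open>R\<close> respectively, so the folded map becomes
    affine on each.\<close>
  define P N where "P = {w::real^'k. w $ k > 0}" and "N = {w::real^'k. w $ k < 0}"
  have PN: "open P" "open N" "P \<inter> N = {}"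
    by (auto simp: P_def N_def intro!: open_Collect_less continuous_intros)
  have clP: "closure P \<subseteq> {w. w $ k \<ge> 0}" and clN: "closure N \<subseteq> {w. w $ k \<le> 0}"
    by (auto simp: P_def N_def intro!: closure_minimal closed_Collect_le continuous_intros)
  have cover: "(\<lambda>w. H (w, 0)) -` {0} \<inter> UNIV \<subseteq> P \<union> N"
  proof
    fix w assume "w \<in> (\<lambda>w. H (w, 0)) -` {0} \<inter> UNIV"
    then have "A w $ k = e $ k" by (simp add: zeros)
    then show "w \<in> P \<union> N" by (auto simp: A_def e_def P_def N_def)
  qed
  have "deg (\<lambda>w. H (w, 0)) P 0 = deg (\<lambda>w. B w + - B e) P 0"
  proof (rule deg_cong)
    show "admissible_triple (\<lambda>w. H (w, 0)) P 0"
      by (rule admissible_triple_part[OF adm, where V' = N]) (use PN cover in auto)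
    fix w assume "w \<in> closure P"
    then have "A w = w" using clP by (auto simp: A_def vec_eq_iff)
    then show "H (w, 0) = B w + - B e" by (simp add: H_def)
  qed
  \<comment> \<open>The only zero of the affine map is \<open>e\<close>, which lies in
    \<open>P\<close>.\<close>
  also have "\<dots> = deg (\<lambda>w. B w + - B e) UNIV 0"
    by (rule deg_excision[symmetric])
      (use admissible_linear[OF assms, of "- B e" 0] PN assms(2) in
        \<open>auto simp: P_def e_def inj_eq\<close>)
  also have "\<dots> = deg B UNIV 0" by (rule deg_affine[OF assms])
  finally have degP: "deg (\<lambda>w. H (w, 0)) P 0 = deg B UNIV 0" .
  have "deg (\<lambda>w. H (w, 0)) N 0 = deg (\<lambda>w. B (R w) + - B e) N 0"
  proof (rule deg_cong)
    show "admissible_triple (\<lambda>w. H (w, 0)) N 0"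
      by (rule admissible_triple_part[OF adm, where V' = P]) (use PN cover in auto)
    fix w assume "w \<in> closure N"
    then have "A w = R w" using clN by (auto simp: A_def R_def vec_eq_iff)
    then show "H (w, 0) = B (R w) + - B e" by (simp add: H_def)
  qed
  also have "\<dots> = deg (\<lambda>w. B (R w) + - B e) UNIV 0"
  proof (rule deg_excision[symmetric])
    show "(\<lambda>w. B (R w) + - B e) -` {0} \<inter> UNIV \<subseteq> N"
    proof
      fix w assume "w \<in> (\<lambda>w. B (R w) + - B e) -` {0} \<inter> UNIV"
      then have "R w $ k = e $ k" using assms(2) by (simp add: inj_eq)
      then show "w \<in> N" by (simp add: R_def e_def N_def)
    qed
  qed (use admissible_linear[OF BR, of "- B e" 0] PN in auto)
  also have "\<dots> = deg (\<lambda>w. B (R w)) UNIV 0" by (rule deg_affine[OF BR])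
  finally have degN: "deg (\<lambda>w. H (w, 0)) N 0 = deg (\<lambda>w. B (R w)) UNIV 0" .
  have "deg (\<lambda>w. H (w, 0)) UNIV 0 = deg (\<lambda>w. H (w, 0)) P 0 + deg (\<lambda>w. H (w, 0)) N 0"
    by (rule deg_additive[OF adm]) (use PN cover in auto)
  then show ?thesis using H0 degP degN by (simp add: R_def)
qed

text \<open>Only the sign of \<open>c\<close> survives, since the diagonal homotopy replaces
  \<open>c\<close> by 1 or by -1, the latter being the reflection. The equation is stated over the
  reals because \<open>sgn c\<close> is real.\<close>

lemma deg_scale_coordinate:
  assumes "linear B" "inj B" "c \<noteq> 0"
  shows "real_of_int (deg (\<lambda>w. B (\<chi> i. (if i = k then c else 1) * w $ i)) UNIV 0) =
    sgn c * real_of_int (deg B UNIV 0)"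
proof (cases "c > 0")
  case True
  have "deg (\<lambda>w. B (\<chi> i. (if i = k then c else 1) * w $ i)) UNIV 0 =
      deg (\<lambda>w. B (\<chi> i. 1 * w $ i)) UNIV 0"
    by (rule deg_diagonal_homotopy) (use assms True in auto)
  then show ?thesis using True by simp
next
  case False
  have "deg (\<lambda>w. B (\<chi> i. (if i = k then c else 1) * w $ i)) UNIV 0 =
      deg (\<lambda>w. B (\<chi> i. (if i = k then - 1 else 1) * w $ i)) UNIV 0"
    by (rule deg_diagonal_homotopy) (use assms False in auto)
  then show ?thesis using False assms deg_reflection[OF assms(1,2)] by simp
qed

text \<open>Scalings already treated are absorbed into the outer map \<open>B \<circ> D\<close>, and
  each new coordinate contributes one sign.\<close>

lemma deg_diagonal:
  assumes "finite S" "linear B" "inj B" "\<And>i. c i \<noteq> 0"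
  shows "real_of_int (deg (\<lambda>w. B (\<chi> i. (if i \<in> S then c i else 1) * w $ i)) UNIV 0) =
    (\<Prod>i\<in>S. sgn (c i)) * real_of_int (deg B UNIV 0)"
  using assms(1)
proof (induction S rule: finite_induct)
  case (insert a S)
  define D :: "real^'k \<Rightarrow> real^'k" where "D = (\<lambda>w. \<chi> i. (if i \<in> S then c i else 1) * w $ i)"
  have lin: "linear (\<lambda>w. B (D w))"
    using linear_compose[OF linear_diagonal assms(2)] by (simp add: D_def o_def)
  have "inj D" unfolding D_def by (rule inj_diagonal) (use assms(4) in auto)
  then have inj: "inj (\<lambda>w. B (D w))"
    using inj_compose[OF assms(3)] by (simp add: o_def)
  have "(\<chi> i. (if i \<in> insert a S then c i else 1) * w $ i) =
      D (\<chi> i. (if i = a then c a else 1) * w $ i)" for w :: "real^'k"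
    using insert.hyps by (auto simp: D_def vec_eq_iff)
  then show ?case
    using deg_scale_coordinate[OF lin inj assms(4), of a a] insert by (simp add: D_def)
qed simp

text \<open>The multiple of coordinate \<open>n\<close> added to coordinate \<open>m\<close> grows
  from 0 to 1. Each stage is injective because it leaves coordinate \<open>n\<close>
  unchanged.\<close>

lemma deg_shear:
  assumes "linear B" "inj B" "m \<noteq> n"
  shows "deg (\<lambda>w. B (\<chi> i. if i = m then w $ m + w $ n else w $ i)) UNIV 0 = deg B UNIV 0"
proof -
  define L where "L = (\<lambda>t w. B (\<chi> i. w $ i + (if i = m then t else 0) * w $ n))"
  have "deg (L 0) UNIV 0 = deg (L 1) UNIV 0"
  proof (rule deg_linear_path)
    fix t :: real
    have "linear (\<lambda>w::real^'k. \<chi> i. w $ i + (if i = m then t else 0) * w $ n)"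
      by (rule linearI) (auto simp: vec_eq_iff algebra_simps)
    then show "linear (L t)"
      using linear_compose[OF _ assms(1)] by (simp add: L_def o_def)
    show "inj (L t)"
    proof (rule injI)
      fix v w assume "L t v = L t w"
      have eq: "v $ i + (if i = m then t else 0) * v $ n =
          w $ i + (if i = m then t else 0) * w $ n" for i
        using \<open>L t v = L t w\<close>[unfolded L_def inj_eq[OF assms(2)]] unfolding vec_eq_iff by simp
      from eq[of n] have "v $ n = w $ n" using assms(3) by simp
      with eq show "v = w" by (simp add: vec_eq_iff)
    qed
  next
    have "continuous_on (UNIV \<times> {0..1}) (\<lambda>p. if i = m then snd p else (0::real))" for i
      by (cases "i = m") (auto intro!: continuous_intros)
    then show "continuous_on (UNIV \<times> {0..1}) (\<lambda>(w, t). L t w)"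
      unfolding L_def case_prod_beta
      by (intro linear_continuous_on_compose[OF _ assms(1)] continuous_intros)
  qed
  moreover have "L 0 = B" by (simp add: L_def fun_eq_iff)
  moreover have "L 1 = (\<lambda>w. B (\<chi> i. if i = m then w $ m + w $ n else w $ i))"
    unfolding L_def by (intro ext arg_cong[where f = B]) (simp add: vec_eq_iff)
  ultimately show ?thesis by simp
qed

text \<open>Every linear map is a composition of elementary ones and both sides are multiplicative,
  so diagonal maps, shears, swaps and maps with a vanishing coordinate suffice.\<close>

lemma deg_linear_comp:
  assumes "linear f" "linear B" "inj B" "det (matrix f) \<noteq> 0"
  shows "real_of_int (deg (\<lambda>w. B (f w)) UNIV 0) =
    sgn (det (matrix f)) * real_of_int (deg B UNIV 0)"
proof -
  \<comment> \<open>Quantifying over \<open>B\<close> lets the claim for \<open>f \<circ> g\<close>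
    use the claim for \<open>g\<close> with \<open>B \<circ> f\<close> in place of \<open>B\<close>.
    The determinant condition sits inside so that singular maps satisfy \<open>P\<close>
    vacuously.\<close>
  define P where "P f \<longleftrightarrow> (\<forall>B. linear B \<longrightarrow> inj B \<longrightarrow> det (matrix f) \<noteq> 0 \<longrightarrow>
    real_of_int (deg (\<lambda>w. B (f w)) UNIV 0) = sgn (det (matrix f)) * real_of_int (deg B UNIV 0))"
    for f :: "real^'k \<Rightarrow> real^'k"
  have comp: "P (f \<circ> g)" if "linear f" "linear g" "P f" "P g" for f g
    unfolding P_def
  proof (intro allI impI)
    fix B :: "real^'k \<Rightarrow> real^'k" assume B: "linear B" "inj B" and nz: "det (matrix (f \<circ> g)) \<noteq> 0"
    have det: "det (matrix (f \<circ> g)) = det (matrix f) * det (matrix g)"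
      using that by (simp add: matrix_compose det_mul)
    have "inj f" using nz det det_nz_iff_inj[OF that(1)] by simp
    then have f: "linear (\<lambda>w. B (f w))" "inj (\<lambda>w. B (f w))"
      using linear_compose[OF that(1) B(1)] inj_compose[OF B(2)] by (simp_all add: o_def)
    show "real_of_int (deg (\<lambda>w. B ((f \<circ> g) w)) UNIV 0) =
        sgn (det (matrix (f \<circ> g))) * real_of_int (deg B UNIV 0)"
      using that(3,4) f B nz det by (auto simp: P_def sgn_mult)
  qed
  have diag: "P (\<lambda>w. \<chi> i. c i * w $ i)" for c
  proof -
    have "det (matrix (\<lambda>w::real^'k. \<chi> i. c i * w $ i)) = (\<Prod>i\<in>UNIV. c i)"
      by (subst det_diagonal) (auto simp: matrix_def axis_def)
    then show ?thesis
      using deg_diagonal[OF finite_class.finite_UNIV, of _ c] by (auto simp: P_def sgn_prod)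
  qed
  have shear: "P (\<lambda>w. \<chi> i. if i = m then w $ m + w $ n else w $ i)" if "m \<noteq> n" for m n
  proof -
    \<comment> \<open>A shear arises from the identity matrix by one row operation, so its
      determinant is 1.\<close>
    have "matrix (\<lambda>w::real^'k. \<chi> i. if i = m then w $ m + w $ n else w $ i) =
        (\<chi> i. if i = m then row m (mat 1) + 1 *s row n (mat 1) else row i (mat 1))"
      by (auto simp: matrix_def row_def mat_def axis_def vec_eq_iff)
    then have "det (matrix (\<lambda>w::real^'k. \<chi> i. if i = m then w $ m + w $ n else w $ i)) = 1"
      using det_row_operation[OF that, where A = "mat 1 :: real^'k^'k" and c = 1] by simp
    then show ?thesis using deg_shear[OF _ _ that] by (simp add: P_def)
  qed
  have "P f"
    using assms(1)
  proof (rule induct_linear_elementary)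
    fix f :: "real^'k \<Rightarrow> real^'k" and i assume "linear f" "\<And>x. f x $ i = 0"
    then have "\<not> surj f" by (metis surjD vec_component zero_neq_one)
    then have "det (matrix f) = 0"
      using \<open>linear f\<close> det_nz_iff_inj linear_injective_imp_surjective by blast
    then show "P f" by (simp add: P_def)
  next
    fix m n :: 'k assume mn: "m \<noteq> n"
    let ?s = "\<lambda>m n (w::real^'k). \<chi> i. if i = m then w $ m + w $ n else w $ i"
    let ?r = "\<lambda>w::real^'k. \<chi> i. (if i = n then - 1 else 1) * w $ i"
    have lin: "linear (?s m n)" "linear (?s n m)" "linear ?r"
      by (rule linearI; auto simp: vec_eq_iff algebra_simps)+
    \<comment> \<open>On the coordinates \<open>(m, n)\<close> the factors, applied from the right,
      take \<open>(a, b)\<close> through \<open>(a + b, b)\<close>, \<open>(a + b, - b)\<close>,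
      \<open>(a + b, a)\<close>, \<open>(a + b, - a)\<close> and \<open>(b, - a)\<close> to
      \<open>(b, a)\<close>.\<close>
    have "(\<lambda>w. \<chi> i. w $ Transposition.transpose m n i) =
        ?r \<circ> (?s m n \<circ> (?r \<circ> (?s n m \<circ> (?r \<circ> ?s m n))))"
      using mn by (auto simp: fun_eq_iff vec_eq_iff Transposition.transpose_def)
    moreover have "P \<dots>"
      using mn by (intro comp lin linear_compose shear diag) auto
    ultimately show "P (\<lambda>w. \<chi> i. w $ Transposition.transpose m n i)" by simp
  qed (rule comp diag shear; assumption)+
  then show ?thesis using assms(2-4) by (simp add: P_def)
qed

lemma deg_linear:
  assumes "linear L" "det (matrix L) \<noteq> 0"
  shows "real_of_int (deg L UNIV 0) = sgn (det (matrix L))"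
  using deg_linear_comp[OF assms(1) linear_id inj_on_id assms(2)] deg_identity by (simp add: id_def)

section \<open>Local degree at regular points and the index formula\<close>

text \<open>On a small sphere around \<open>x\<close> the linear part has norm at least
  \<open>c * r\<close> and the remainder at most half of that, so the affine homotopy to the
  linearisation avoids \<open>f x\<close> there. The eventual form lets finitely many points share
  one radius.\<close>

lemma deg_regular_point:
  assumes "(f has_derivative L) (at x)" "det (matrix L) \<noteq> 0"
    and "open U" "x \<in> U" "continuous_on U f"
  shows "\<forall>\<^sub>F r in at_right 0. real_of_int (deg f (ball x r) (f x)) = sgn (det (matrix L))"
proof -
  have lin: "linear L" using assms(1) by (rule has_derivative_linear)
  have inj: "inj L" using assms(2) det_nz_iff_inj[OF lin] by simp
  obtain c where c: "c > 0" "\<And>h. c * norm h \<le> norm (L h)"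
    using linear_inj_bounded_below_pos[OF lin inj] by metis
  from assms(1) c(1) obtain d where d: "d > 0"
    "\<And>w. norm (w - x) < d \<Longrightarrow> norm (f w - f x - L (w - x)) \<le> c / 2 * norm (w - x)"
    unfolding has_derivative_at_alt by (meson half_gt_zero)
  obtain R where R: "R > 0" "cball x R \<subseteq> U" using assms(3,4) open_contains_cball by metis
  \<comment> \<open>With this \<open>a\<close>, the map \<open>\<lambda>w. L w + a\<close> is the
    linearisation of \<open>f\<close> at \<open>x\<close> and takes the value \<open>f x\<close>
    only at \<open>x\<close>.\<close>
  define a where "a = f x - L x"
  have "real_of_int (deg f (ball x r) (f x)) = sgn (det (matrix L))"
    if r: "0 < r" "r < min R d" for r
  proof -
    let ?H = "\<lambda>(w, t). (1 - t) *\<^sub>R f w + t *\<^sub>R (L w + a)"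
    have "continuous_on (cball x r) f"
      by (rule continuous_on_subset[OF assms(5)]) (use r R in auto)
    then have cont: "continuous_on (cball x r \<times> {0..1}) ?H"
      unfolding case_prod_beta
      by (intro continuous_intros linear_continuous_on_compose[OF _ lin]
          continuous_on_compose2[where f = fst and g = f]) auto
    have "?H (w, t) \<noteq> f x" if w: "w \<in> sphere x r" and t: "t \<in> {0..1}" for w t
    proof
      assume eq: "?H (w, t) = f x"
      have nw: "norm (w - x) = r" using w by (simp add: dist_norm norm_minus_commute)
      have "L (w - x) = - ((1 - t) *\<^sub>R (f w - f x - L (w - x)))"
        using eq by (simp add: a_def linear_diff[OF lin] algebra_simps)
      then have "norm (L (w - x)) = norm ((1 - t) *\<^sub>R (f w - f x - L (w - x)))"
        by (metis norm_minus_cancel)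
      also have "\<dots> = (1 - t) * norm (f w - f x - L (w - x))" using t by simp
      also have "\<dots> \<le> norm (f w - f x - L (w - x))"
        using t by (intro mult_left_le_one_le) auto
      also have "\<dots> \<le> c / 2 * r" using d(2)[of w] nw r by simp
      finally have "c * r \<le> c / 2 * r" using c(2)[of "w - x"] nw by simp
      then show False using c(1) r(1) by simp
    qed
    then have "admissible_homotopy ?H (ball x r) (\<lambda>_. f x)"
      using r cont proper_on_compact[OF compact_Times[OF compact_cball compact_Icc] cont]
      by (simp add: admissible_homotopy_def path_def frontier_ball)
    then have "deg f (ball x r) (f x) = deg (\<lambda>w. L w + a) (ball x r) (f x)"
      by (rule deg_homotopy) auto
    also have "\<dots> = deg (\<lambda>w. L w + a) UNIV (f x)"
    proof (rule deg_excision[symmetric, OF admissible_linear[OF lin inj]])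
      show "(\<lambda>w. L w + a) -` {f x} \<inter> UNIV \<subseteq> ball x r"
        using inj r by (auto simp: a_def inj_eq)
    qed auto
    also have "\<dots> = deg L UNIV 0" by (rule deg_affine[OF lin inj])
    finally show ?thesis using deg_linear[OF lin assms(2)] by simp
  qed
  then show ?thesis
    unfolding eventually_at_right_field using R(1) d(1) by (intro exI[of _ "min R d"]) auto
qed

text \<open>Disjoint balls of one small radius around the finitely many zeros turn the degree into a
  sum of local degrees.\<close>

lemma deg_regular_triple:
  assumes "regular_triple g U z"
  shows "deg g U z = (\<Sum>x\<in>g -` {z} \<inter> U. index g x)"
proof -
  define Z where "Z = g -` {z} \<inter> U"
  have fin: "finite Z" using regular_triple_finite[OF assms] by (simp add: Z_def)
  have adm: "admissible_triple g U z" and opn: "open U"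
    using assms by (auto simp: regular_triple_def admissible_triple_def)
  have cont: "continuous_on U g"
    using adm continuous_on_subset[OF _ closure_subset, of U g] by (simp add: admissible_triple_def)
  have loc: "\<forall>\<^sub>F r in at_right 0. deg g (ball x r) z = index g x" if x: "x \<in> Z" for x
  proof -
    obtain W F where W: "open W" "closure U \<subseteq> W" "\<And>n. Cn_on n W F"
        "\<And>x. x \<in> closure U \<Longrightarrow> F x = g x"
      using assms unfolding regular_triple_def Cinf_on_def by blast
    have xU: "x \<in> U" "g x = z" using x by (auto simp: Z_def)
    \<comment> \<open>\<open>F\<close> is the smooth extension; \<open>g\<close> equals it on the
      open set \<open>U\<close>, so \<open>g\<close> is differentiable at \<open>x\<close>
      too.\<close>
    have "F differentiable (at x)"
      using W(3)[of "Suc 0"] W(2) xU closure_subset[of U] by auto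
    then obtain D where "(F has_derivative D) (at x)" by (auto simp: differentiable_def)
    then have "(g has_derivative D) (at x)"
      by (rule has_derivative_transform_within_open[OF _ opn xU(1)])
        (use W(4) closure_subset[of U] in auto)
    then have "(g has_derivative frechet_derivative g (at x)) (at x)"
      by (metis differentiable_def frechet_derivative_works)
    moreover have nz: "jac_det g x \<noteq> 0" using assms x by (auto simp: regular_triple_def Z_def)
    ultimately have
      "\<forall>\<^sub>F r in at_right 0. real_of_int (deg g (ball x r) (g x)) = sgn (jac_det g x)"
      using deg_regular_point[OF _ _ opn xU(1) cont] by (simp add: jac_det_def)
    then show ?thesis
      \<comment> \<open>As the Jacobian is nonzero, the real sign is 1 or -1 and the equation
        descends to the integers.\<close>
      by eventually_elim (use nz xU in \<open>auto simp: index_def sgn_if split: if_splits\<close>)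
  qed
  have sub: "\<forall>\<^sub>F r in at_right 0. ball x r \<subseteq> U" if "x \<in> Z" for x
  proof -
    have "x \<in> U" using that by (simp add: Z_def)
    then obtain e where "e > 0" "ball x e \<subseteq> U" using opn by (meson open_contains_ball)
    then show ?thesis
      unfolding eventually_at_right_field by (intro exI[of _ e]) auto
  qed
  have disj: "\<forall>\<^sub>F r in at_right 0. x \<noteq> x' \<longrightarrow> ball x r \<inter> ball x' r = {}" for x x' :: "real^'k"
  proof (cases "x = x'")
    case False
    then show ?thesis
      unfolding eventually_at_right_field
      by (intro exI[of _ "dist x x' / 2"]) (auto intro!: disjoint_ballI)
  qed auto
  \<comment> \<open>Finitely many conditions, each valid for all small positive \<open>r\<close>,
    hold together for some \<open>r\<close>.\<close>
  have "\<forall>\<^sub>F r in at_right (0::real). 0 < r \<and> (\<forall>x\<in>Z. deg g (ball x r) z = index g x) \<and>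
      (\<forall>x\<in>Z. ball x r \<subseteq> U) \<and> (\<forall>x\<in>Z. \<forall>x'\<in>Z. x \<noteq> x' \<longrightarrow> ball x r \<inter> ball x' r = {})"
    by (intro eventually_conj eventually_ball_finite fin ballI loc sub disj eventually_at_right_less)
  from eventually_happens'[OF trivial_limit_at_right_real this]
  obtain r where r: "0 < r" "\<forall>x\<in>Z. deg g (ball x r) z = index g x" "\<forall>x\<in>Z. ball x r \<subseteq> U"
      "\<forall>x\<in>Z. \<forall>x'\<in>Z. x \<noteq> x' \<longrightarrow> ball x r \<inter> ball x' r = {}"
    by (elim exE conjE) (rule that)
  have "deg g U z = (\<Sum>x\<in>Z. deg g (ball x r) z)"
  proof (rule deg_additive_finite[OF fin adm])
    show "disjoint_family_on (\<lambda>x. ball x r) Z" using r(4) by (simp add: disjoint_family_on_def)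
    show "g -` {z} \<inter> U \<subseteq> (\<Union>x\<in>Z. ball x r)" using r(1) by (auto simp: Z_def)
  qed (use r(3) in auto)
  then show ?thesis using r(2) by (simp add: Z_def)
qed

end

section \<open>Joining nearby triples by an affine homotopy\<close>

text \<open>The homotopy stays within \<epsilon> of \<open>f\<close> and the moving target within
  \<sigma> of \<open>y\<close>; if they met over a frontier point \<open>x\<close>, then
  \<open>f x\<close> would be too close to \<open>y\<close>.\<close>

lemma close_imp_admissibly_joined:
  fixes f g :: "real^'k \<Rightarrow> real^'k"
  assumes f: "admissible_triple f U y" and g: "continuous_on (closure U) g"
    and \<epsilon>: "\<And>x. x \<in> closure U \<Longrightarrow> norm (g x - f x) \<le> \<epsilon>" and \<sigma>: "norm (z - y) \<le> \<sigma>"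
    and dist: "ereal (\<epsilon> + \<sigma>) < edist_set y (f ` frontier U)"
  shows "admissibly_joined U g z f y"
proof -
  let ?X = "closure U \<times> {0..1::real}"
  define H where "H = (\<lambda>(x, t). f x + (1 - t) *\<^sub>R (g x - f x))"
  define \<alpha> where "\<alpha> = (\<lambda>t::real. y + (1 - t) *\<^sub>R (z - y))"
  have contf: "continuous_on (closure U) f" and proper: "proper_on (closure U) f"
    using f by (auto simp: admissible_triple_def)
  have H_f: "norm (H (x, t) - f x) \<le> \<epsilon>" if "x \<in> closure U" "t \<in> {0..1}" for x t
  proof -
    have "norm (H (x, t) - f x) = (1 - t) * norm (g x - f x)" using that by (simp add: H_def)
    also have "\<dots> \<le> norm (g x - f x)" using that by (intro mult_left_le_one_le) auto
    finally show ?thesis using \<epsilon>[OF that(1)] by simp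
  qed
  have cont: "continuous_on ?X H"
    unfolding H_def case_prod_beta
    by (intro continuous_intros continuous_on_compose2[OF contf] continuous_on_compose2[OF g]) auto
  have "proper_on ?X H"
  proof (rule proper_on_bounded_preimage[OF _ cont])
    show "closed ?X" by (intro closed_Times) auto
    fix K :: "(real^'k) set" assume "compact K"
    then obtain R where R: "\<And>v. v \<in> K \<Longrightarrow> norm v \<le> R"
      using compact_imp_bounded bounded_iff by metis
    \<comment> \<open>Where \<open>H\<close> takes values in a ball, \<open>f\<close> takes values
      in the ball enlarged by \<epsilon>, and properness of \<open>f\<close> bounds the set of such
      points.\<close>
    have "norm (f x) \<le> R + \<epsilon>" if "x \<in> closure U" "t \<in> {0..1}" "H (x, t) \<in> K" for x t
      using H_f[OF that(1,2)] R[OF that(3)] norm_triangle_ineq4[of "H (x, t)" "H (x, t) - f x"]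
      by simp
    then have "?X \<inter> H -` K \<subseteq> (closure U \<inter> f -` cball 0 (R + \<epsilon>)) \<times> {0..1}" by auto
    moreover have "bounded (closure U \<inter> f -` cball 0 (R + \<epsilon>))"
      using proper by (auto simp: proper_on_def intro!: compact_imp_bounded)
    ultimately show "bounded (?X \<inter> H -` K)"
      using bounded_Times[OF _ bounded_closed_interval] bounded_subset by blast
  qed
  moreover have "H (x, t) \<noteq> \<alpha> t" if x: "x \<in> frontier U" and t: "t \<in> {0..1}" for x t
  proof
    assume eq: "H (x, t) = \<alpha> t"
    have "norm (\<alpha> t - y) = (1 - t) * norm (z - y)" using t by (simp add: \<alpha>_def)
    also have "\<dots> \<le> norm (z - y)" using t by (intro mult_left_le_one_le) auto
    finally have "norm (\<alpha> t - y) \<le> \<sigma>" using \<sigma> by simp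
    moreover have "norm (H (x, t) - f x) \<le> \<epsilon>" using x t by (intro H_f) (auto simp: frontier_def)
    moreover have "dist y (f x) \<le> norm (\<alpha> t - y) + norm (H (x, t) - f x)"
      using norm_triangle_ineq4[of "\<alpha> t - f x" "\<alpha> t - y"] eq
      by (simp add: dist_norm)
    moreover have "infdist y (f ` frontier U) \<le> dist y (f x)" using x by (intro infdist_le) auto
    \<comment> \<open>As \<open>x\<close> lies in \<open>frontier U\<close>, the image is nonempty
      and \<open>edist_set\<close> is a finite distance.\<close>
    moreover have "\<epsilon> + \<sigma> < infdist y (f ` frontier U)"
      using dist x by (auto simp: edist_set_def split: if_splits)
    ultimately show False by linarith
  qed
  moreover have "path \<alpha>" unfolding path_def \<alpha>_def by (intro continuous_intros)
  ultimately have "admissible_homotopy H U \<alpha>"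
    using f cont by (simp add: admissible_homotopy_def admissible_triple_def)
  then show ?thesis
    unfolding admissibly_joined_def by (intro exI[of _ H] exI[of _ \<alpha>]) (simp add: H_def \<alpha>_def)
qed

theorem theorem3p17:
  fixes deg :: "(real^'k \<Rightarrow> real^'k) \<Rightarrow> (real^'k) set \<Rightarrow> real^'k \<Rightarrow> int"
    and f :: "real^'k \<Rightarrow> real^'k" and U :: "(real^'k) set" and y :: "real^'k"
  assumes "is_degree deg" and "admissible_triple f U y"
  shows
    "(\<forall>g z. regular_triple g U z \<and> admissibly_joined U g z f y \<longrightarrow>
        deg f U y = (\<Sum>x\<in>g -` {z} \<inter> U. index g x)) \<and>
     (\<forall>g z. regular_triple g U z \<and>
        (\<exists>\<epsilon> \<sigma>. \<epsilon> > 0 \<and> \<sigma> > 0 \<and>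
           (\<forall>x\<in>closure U. norm (g x - f x) \<le> \<epsilon>) \<and>
           norm (z - y) \<le> \<sigma> \<and>
           ereal (\<epsilon> + \<sigma>) < edist_set y (f ` frontier U)) \<longrightarrow>
        deg f U y = (\<Sum>x\<in>g -` {z} \<inter> U. index g x))"
proof -
  interpret degree_map deg using assms(1) by (rule degree_map.intro)
  have joined: "deg f U y = (\<Sum>x\<in>g -` {z} \<inter> U. index g x)"
    if reg: "regular_triple g U z" and "admissibly_joined U g z f y" for g z
  proof -
    obtain H \<alpha> where "admissible_homotopy H U \<alpha>" "\<And>x. x \<in> closure U \<Longrightarrow> H (x, 0) = g x" "\<alpha> 0 = z"
        "\<And>x. x \<in> closure U \<Longrightarrow> H (x, 1) = f x" "\<alpha> 1 = y"
      using \<open>admissibly_joined U g z f y\<close> unfolding admissibly_joined_def by blast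
    then have "deg g U z = deg f U y" by (rule deg_homotopy)
    then show ?thesis using deg_regular_triple[OF reg] by simp
  qed
  \<comment> \<open>The second claim is thus an instance of the first; continuity of
    \<open>g\<close> comes with regularity of the triple.\<close>
  moreover have "admissibly_joined U g z f y"
    if "regular_triple g U z" "\<forall>x\<in>closure U. norm (g x - f x) \<le> \<epsilon>" "norm (z - y) \<le> \<sigma>"
      "ereal (\<epsilon> + \<sigma>) < edist_set y (f ` frontier U)" for g z \<epsilon> \<sigma>
    by (rule close_imp_admissibly_joined[OF assms(2) _ _ that(3,4)])
      (use that(1,2) in \<open>auto simp: regular_triple_def admissible_triple_def\<close>)
  ultimately show ?thesis by blast
qed

end
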